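(* Let $d\in\mathbb{N}$, $\gamma\in(0,1)$, $\alpha>\frac{1-\gamma}{\gamma}$, and let $f=(f^1,\dots,f^d)\colon[0,1]\to\mathbb{R}^d$ be a $\gamma$-H\"older continuous function with $f(0)=0$. Suppose that $f$ is not identically $0$. Then the deterministic equation $$X_t^i=-\int_0^t\operatorname{sign}(X_s^i)\,|X_s|^{-\alpha}\,\mathbf{1}(|X_s|<1)\,ds+f_t^i,\qquad i=1,\dots,d,\quad t\in[0,1],$$ where the integral is understood in the Lebesgue sense, has no continuous solutions $X=(X^1,\dots,X^d)\colon[0,1]\to\mathbb{R}^d$.
   Context: $|\cdot|$ is the Euclidean norm on $\mathbb{R}^d$. Convention: $\operatorname{sign}(0)=0$, and the integrand is taken to be $0$ when $X_s=0$. *)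

theory Defs
  imports "HOL-Analysis.Analysis"
begin

definition holder_continuous_on ::
    "real \<Rightarrow> real set \<Rightarrow> (real \<Rightarrow> 'a::metric_space) \<Rightarrow> bool" where
  "holder_continuous_on \<gamma> S f \<longleftrightarrow>
     (\<exists>C. \<forall>s\<in>S. \<forall>t\<in>S. dist (f s) (f t) \<le> C * \<bar>s - t\<bar> powr \<gamma>)"

(* At x = 0 every component vanishes, since sgn 0 = 0. *)
definition drift :: "real \<Rightarrow> real ^ 'n \<Rightarrow> real ^ 'n" where
  "drift \<alpha> x =
     (\<chi> i. sgn (x $ i) * norm x powr (- \<alpha>) * (if norm x < 1 then 1 else 0))"

(* Integrability is demanded explicitly because the Bochner integral of a
   non-integrable function is 0 by convention. Only the values of f and X on [0,1] matter. *)
definition is_continuous_solution ::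
    "real \<Rightarrow> (real \<Rightarrow> real ^ 'n) \<Rightarrow> (real \<Rightarrow> real ^ 'n) \<Rightarrow> bool" where
  "is_continuous_solution \<alpha> f X \<longleftrightarrow>
     continuous_on {0..1} X \<and>
     (\<forall>t\<in>{0..1}. \<forall>i.
        set_integrable lebesgue {0..t} (\<lambda>s. drift \<alpha> (X s) $ i) \<and>
        X t $ i = - (LINT s:{0..t}|lebesgue. drift \<alpha> (X s) $ i) + f t $ i)"

end

theory Submission
  imports Defs
begin

text \<open>A solution starts at 0, and the drift pulls every nonzero component towards 0. Let \<open>T\<close> be the
  first time at which \<open>|X| = \<delta>\<close>, for a small \<open>\<delta>\<close>, and let \<open>T - \<tau>\<close> be the last zero of the \<open>i\<close>-th
  component before \<open>T\<close>. Since \<open>|X| \<le> \<delta>\<close> up to time \<open>T\<close>, the drift has contributed at least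
  \<open>\<delta>\<^sup>-\<^sup>\<alpha> \<tau>\<close> towards 0 since then, so \<open>|X\<^sup>i| + \<delta>\<^sup>-\<^sup>\<alpha> \<tau> \<le> C \<tau>\<^sup>\<gamma>\<close> at time \<open>T\<close>. Eliminating \<open>\<tau>\<close> gives
  \<open>|X\<^sup>i| \<le> C' \<delta>\<^sup>p\<close> with \<open>p = \<alpha>\<gamma> / (1 - \<gamma>) > 1\<close>; summing over \<open>i\<close> yields \<open>\<delta> \<le> d C' \<delta>\<^sup>p\<close>, which is
  impossible for small \<open>\<delta>\<close>.\<close>

text \<open>The part of \<open>{a..b}\<close> where \<open>\<phi>\<close> is at least
  \<open>\<delta>\<close> is compact, so it has a least point \<open>T\<close>.\<close>

lemma first_hitting_time:
  fixes \<phi> :: "real \<Rightarrow> real"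
  assumes cont: "continuous_on {a..b} \<phi>" and start: "\<phi> a < \<delta>"
    and t: "t \<in> {a..b}" "\<delta> \<le> \<phi> t"
  obtains T where "T \<in> {a<..b}" "\<phi> T = \<delta>" "\<And>s. s \<in> {a..T} \<Longrightarrow> \<phi> s \<le> \<delta>"
proof -
  define S where "S = {a..b} \<inter> \<phi> -` {\<delta>..}"
  have "closed S" unfolding S_def
    by (intro continuous_closed_preimage cont) auto
  then have "compact S"
    using compact_Int_closed[of "{a..b}" S] by (simp add: S_def Int_assoc[symmetric])
  moreover have "S \<noteq> {}" using t by (auto simp: S_def)
  ultimately obtain T where T: "T \<in> S" "\<And>s. s \<in> S \<Longrightarrow> T \<le> s"
    using compact_attains_inf[of S] by blast
  have "continuous_on {a..T} \<phi>"
    using cont by (rule continuous_on_subset) (use T in \<open>auto simp: S_def\<close>)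
  then obtain s where "a \<le> s" "s \<le> T" "\<phi> s = \<delta>"
    using IVT'[of \<phi> a \<delta> T] T start by (auto simp: S_def)
  \<comment> \<open>The point given by the intermediate value theorem lies in \<open>S\<close> and
    is at most \<open>T\<close>, so minimality makes it \<open>T\<close>.\<close>
  with T have hit: "\<phi> T = \<delta>" by (force simp: S_def)
  with start have "T \<noteq> a" by auto
  moreover have "\<phi> s \<le> \<delta>" if "s \<in> {a..T}" for s
  proof (rule ccontr)
    assume less: "\<not> \<phi> s \<le> \<delta>"
    then have "s \<in> S" using that T(1) by (auto simp: S_def)
    then have "s = T" using T(2)[of s] that by simp
    with hit less show False by simp
  qed
  ultimately show thesis using that[of T] hit T(1) by (auto simp: S_def)
qed

text \<open>The zero set is compact, so it has a greatest point; any later change of sign would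
  produce a further zero.\<close>

lemma last_zero:
  fixes x :: "real \<Rightarrow> real"
  assumes cont: "continuous_on {a..T} x" and zero: "x a = 0" and "x T \<noteq> 0" "a \<le> T"
  obtains s where "s \<in> {a..<T}" "x s = 0" "\<And>u. u \<in> {s<..T} \<Longrightarrow> sgn (x u) = sgn (x T)"
proof -
  define S where "S = {a..T} \<inter> x -` {0}"
  have "closed S" unfolding S_def
    by (intro continuous_closed_preimage cont) auto
  then have "compact S"
    using compact_Int_closed[of "{a..T}" S] by (simp add: S_def Int_assoc[symmetric])
  moreover have "S \<noteq> {}" using assms by (auto simp: S_def)
  ultimately obtain s where s: "s \<in> S" "\<And>u. u \<in> S \<Longrightarrow> u \<le> s"
    using compact_attains_sup[of S] by blast
  have sgn_eq: "sgn (x u) = sgn (x T)" if u: "u \<in> {s<..T}" for u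
  proof (rule ccontr)
    assume "sgn (x u) \<noteq> sgn (x T)"
    then have "x u \<le> 0 \<and> 0 \<le> x T \<or> x T \<le> 0 \<and> 0 \<le> x u"
      by (auto simp: sgn_if split: if_splits)
    moreover have "continuous_on {u..T} x"
      using cont by (rule continuous_on_subset) (use u s in \<open>auto simp: S_def\<close>)
    ultimately obtain v where "u \<le> v" "v \<le> T" "x v = 0"
      using IVT'[of x u 0 T] IVT2'[of x T 0 u] u by auto
    then have "v \<in> S" using s(1) u by (auto simp: S_def)
    with s(2) u \<open>u \<le> v\<close> show False by force
  qed
  have "s \<noteq> T" using s(1) \<open>x T \<noteq> 0\<close> by (auto simp: S_def)
  then show thesis using s(1) by (intro that[OF _ _ sgn_eq]) (auto simp: S_def)
qed

text \<open>Subtracting the equation at the last zero \<open>s\<close> from the one at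
  \<open>T\<close> leaves only the drift over \<open>{s<..T}\<close>. There \<open>x\<close> keeps
  its sign, so the drift opposes that sign at rate at least \<open>m\<close>, and the increment of
  \<open>h\<close> must make up for it.\<close>

lemma restoring_drift_bound:
  fixes x g h :: "real \<Rightarrow> real"
  assumes cont: "continuous_on {0..T} x" and zero: "x 0 = 0" and "x T \<noteq> 0" "0 \<le> T"
    and int: "set_integrable lebesgue {0..T} g"
    and eq: "\<And>t. t \<in> {0..T} \<Longrightarrow> x t = - (LINT s:{0..t}|lebesgue. g s) + h t"
    and drift: "\<And>t. t \<in> {0..T} \<Longrightarrow> x t \<noteq> 0 \<Longrightarrow> m \<le> sgn (x t) * g t"
  obtains s where "s \<in> {0..<T}" "\<bar>x T\<bar> + m * (T - s) \<le> \<bar>h T - h s\<bar>"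
proof -
  obtain s where s: "s \<in> {0..<T}" "x s = 0" "\<And>u. u \<in> {s<..T} \<Longrightarrow> sgn (x u) = sgn (x T)"
    using last_zero[OF cont zero \<open>x T \<noteq> 0\<close> \<open>0 \<le> T\<close>] by blast
  let ?\<sigma> = "sgn (x T)"
  have int1: "set_integrable lebesgue {0..s} g"
    using int by (rule set_integrable_subset) (use s in auto)
  \<comment> \<open>Open at \<open>s\<close>: disjoint from \<open>{0..s}\<close>, and free of zeros
    of \<open>x\<close>, where no lower bound on \<open>g\<close> is assumed.\<close>
  have int2: "set_integrable lebesgue {s<..T} g"
    using int by (rule set_integrable_subset) (use s in auto)
  have "{0..T} = {0..s} \<union> {s<..T}" using s by auto
  then have split: "(LINT u:{0..T}|lebesgue. g u)
      = (LINT u:{0..s}|lebesgue. g u) + (LINT u:{s<..T}|lebesgue. g u)"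
    using set_integral_Un[OF _ int1 int2] by (simp add: disjoint_iff)
  have pull: "m * (T - s) \<le> ?\<sigma> * (LINT u:{s<..T}|lebesgue. g u)"
  proof -
    have "m * (T - s) = (LINT u:{s<..T}|lebesgue. m)"
      using s by (simp add: set_integral_const)
    also have "\<dots> \<le> (LINT u:{s<..T}|lebesgue. ?\<sigma> * g u)"
    proof (rule set_integral_mono)
      show "set_integrable lebesgue {s<..T} (\<lambda>_. m)"
        by (intro absolutely_integrable_on_const bounded_set_imp_lmeasurable) auto
      show "set_integrable lebesgue {s<..T} (\<lambda>u. ?\<sigma> * g u)"
        using int2 by simp
      fix u assume u: "u \<in> {s<..T}"
      then have "x u \<noteq> 0" using s(3)[OF u] \<open>x T \<noteq> 0\<close> by (metis sgn_zero_iff)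
      then show "m \<le> ?\<sigma> * g u" using drift[of u] s(1) s(3)[OF u] u by auto
    qed
    also have "\<dots> = ?\<sigma> * (LINT u:{s<..T}|lebesgue. g u)" by simp
    finally show ?thesis .
  qed
  have "x T = (h T - h s) - (LINT u:{s<..T}|lebesgue. g u)"
    using eq[of T] eq[of s] split s(1,2) \<open>0 \<le> T\<close> by auto
  then have "?\<sigma> * x T = ?\<sigma> * (h T - h s) - ?\<sigma> * (LINT u:{s<..T}|lebesgue. g u)"
    by (metis right_diff_distrib)
  then have "\<bar>x T\<bar> + m * (T - s) \<le> ?\<sigma> * (h T - h s)"
    using pull by (simp add: abs_sgn mult.commute)
  also have "\<dots> \<le> \<bar>h T - h s\<bar>" using \<open>x T \<noteq> 0\<close> by (auto simp: sgn_if)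
  finally show thesis using that s(1) by blast
qed

text \<open>Without \<open>y\<close>, the hypothesis bounds
  \<open>\<tau> powr (1 - \<gamma>)\<close> by \<open>C * \<delta> powr \<alpha>\<close>. Raising
  this to the power \<open>\<gamma> / (1 - \<gamma>)\<close> bounds
  \<open>\<tau> powr \<gamma>\<close>, hence the right-hand side that dominates
  \<open>y\<close>.\<close>

lemma powr_balance:
  fixes C \<gamma> \<alpha> \<delta> \<tau> y :: real
  assumes "0 < \<gamma>" "\<gamma> < 1" "0 < \<delta>" "0 < C" "0 < \<tau>" "0 \<le> y"
    and le: "y + \<delta> powr (-\<alpha>) * \<tau> \<le> C * \<tau> powr \<gamma>"
  shows "y \<le> C * C powr (\<gamma> / (1 - \<gamma>)) * \<delta> powr (\<alpha> * \<gamma> / (1 - \<gamma>))"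
proof -
  have "\<delta> powr (-\<alpha>) * \<tau> \<le> C * \<tau> powr \<gamma>" using le \<open>0 \<le> y\<close> by linarith
  moreover have "\<tau> = \<tau> powr (1 - \<gamma>) * \<tau> powr \<gamma>"
    using \<open>0 < \<tau>\<close> by (simp add: powr_add[symmetric])
  ultimately have "\<delta> powr (-\<alpha>) * \<tau> powr (1 - \<gamma>) \<le> C"
    using \<open>0 < \<tau>\<close> mult_le_cancel_right_pos[of "\<tau> powr \<gamma>" "\<delta> powr (-\<alpha>) * \<tau> powr (1 - \<gamma>)" C]
    by (simp add: mult.assoc)
  then have "\<tau> powr (1 - \<gamma>) \<le> C * \<delta> powr \<alpha>"
    using \<open>0 < \<delta>\<close> by (simp add: powr_minus field_simps)
  then have "(\<tau> powr (1 - \<gamma>)) powr (\<gamma> / (1 - \<gamma>)) \<le> (C * \<delta> powr \<alpha>) powr (\<gamma> / (1 - \<gamma>))"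
    using assms by (intro powr_mono2) auto
  then have "\<tau> powr \<gamma> \<le> C powr (\<gamma> / (1 - \<gamma>)) * \<delta> powr (\<alpha> * \<gamma> / (1 - \<gamma>))"
    using assms by (simp add: powr_powr powr_mult)
  then have "C * \<tau> powr \<gamma> \<le> C * (C powr (\<gamma> / (1 - \<gamma>)) * \<delta> powr (\<alpha> * \<gamma> / (1 - \<gamma>)))"
    using \<open>0 < C\<close> by (intro mult_left_mono) auto
  moreover have "0 \<le> \<delta> powr (-\<alpha>) * \<tau>" using assms by simp
  ultimately show ?thesis using le by (simp add: mult.assoc)
qed

lemma sgn_mult_drift_ge:
  assumes "0 \<le> \<alpha>" "norm x \<le> \<delta>" "\<delta> < 1" "x $ i \<noteq> 0"
  shows "\<delta> powr (-\<alpha>) \<le> sgn (x $ i) * drift \<alpha> x $ i"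
proof -
  have "x \<noteq> 0" using \<open>x $ i \<noteq> 0\<close> by auto
  then have "\<delta> powr (-\<alpha>) \<le> norm x powr (-\<alpha>)"
    using assms by (intro powr_mono2') auto
  then show ?thesis using assms by (auto simp: drift_def sgn_if)
qed

theorem theorem2p6:
  fixes \<gamma> \<alpha> :: real and f :: "real \<Rightarrow> real ^ 'd"
  assumes "0 < \<gamma>" and "\<gamma> < 1"
    and "\<alpha> > (1 - \<gamma>) / \<gamma>"
    and "holder_continuous_on \<gamma> {0..1} f"
    and "f 0 = 0"
    and "\<exists>t\<in>{0..1}. f t \<noteq> 0"
  shows "\<not> (\<exists>X :: real \<Rightarrow> real ^ 'd. is_continuous_solution \<alpha> f X)"
proof
  assume "\<exists>X :: real \<Rightarrow> real ^ 'd. is_continuous_solution \<alpha> f X"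
  then obtain X :: "real \<Rightarrow> real ^ 'd" where cont: "continuous_on {0..1} X"
    and int: "\<And>t i. t \<in> {0..1} \<Longrightarrow> set_integrable lebesgue {0..t} (\<lambda>s. drift \<alpha> (X s) $ i)"
    and eq: "\<And>t i. t \<in> {0..1} \<Longrightarrow>
      X t $ i = - (LINT s:{0..t}|lebesgue. drift \<alpha> (X s) $ i) + f t $ i"
    unfolding is_continuous_solution_def by blast
  have "0 < (1 - \<gamma>) / \<gamma>" using assms(1,2) by simp
  then have "0 < \<alpha>" using assms(3) by linarith
  define p where "p = \<alpha> * \<gamma> / (1 - \<gamma>)"
  \<comment> \<open>This is equivalent to
    \<open>\<alpha> > (1 - \<gamma>) / \<gamma>\<close>.\<close>
  have "1 < p" using assms(1-3) by (simp add: p_def field_simps)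
  obtain C0 where C0: "\<And>s t. s \<in> {0..1} \<Longrightarrow> t \<in> {0..1} \<Longrightarrow> dist (f s) (f t) \<le> C0 * \<bar>s - t\<bar> powr \<gamma>"
    using assms(4) unfolding holder_continuous_on_def by blast
  \<comment> \<open>The maximum with 1 ensures the positivity that \<open>powr_balance\<close>
    requires.\<close>
  define C where "C = max C0 1"
  have "0 < C" by (simp add: C_def)
  have holder: "\<bar>f t $ i - f s $ i\<bar> \<le> C * (t - s) powr \<gamma>"
    if "s \<in> {0..1}" "t \<in> {0..1}" "s \<le> t" for s t i
  proof -
    have "\<bar>f t $ i - f s $ i\<bar> \<le> dist (f t) (f s)"
      using component_le_norm_cart[of "f t - f s" i] by (simp add: dist_norm)
    also have "\<dots> \<le> C0 * (t - s) powr \<gamma>" using C0[of t s] that by simp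
    also have "\<dots> \<le> C * (t - s) powr \<gamma>" by (intro mult_right_mono) (auto simp: C_def)
    finally show ?thesis .
  qed

  have "X 0 $ i = 0" for i
  proof -
    have "(LINT s:{0..0}|lebesgue. drift \<alpha> (X s) $ i) = 0"
      using integral_eq_zero_null_sets[of "{0}" "\<lambda>s. drift \<alpha> (X s) $ i"]
      by (simp add: set_lebesgue_integral_def integral_restrict_space)
    then show ?thesis using eq[of 0 i] \<open>f 0 = 0\<close> by simp
  qed
  then have X0: "X 0 = 0" by (simp add: vec_eq_iff)
  \<comment> \<open>If \<open>X\<close> vanished throughout, so would the drift, and the equation
    would give \<open>f = 0\<close> on \<open>{0..1}\<close>.\<close>
  obtain t0 where t0: "t0 \<in> {0..1}" "X t0 \<noteq> 0"
  proof (rule ccontr)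
    assume "\<not> thesis"
    with that have "X t = 0" if "t \<in> {0..1}" for t using that by blast
    then have "drift \<alpha> (X s) $ i = 0" if "s \<in> {0..1}" for s i
      using that by (simp add: drift_def)
    then have "(LINT s:{0..t}|lebesgue. drift \<alpha> (X s) $ i)
        = (LINT s:{0..t}|lebesgue. 0)" if "t \<in> {0..1}" for t i
      using that by (intro set_lebesgue_integral_cong) auto
    then have "f t = 0" if "t \<in> {0..1}" for t
      using that eq[of t] \<open>\<And>t. t \<in> {0..1} \<Longrightarrow> X t = 0\<close> by (simp add: vec_eq_iff)
    with assms(6) show False by blast
  qed

  \<comment> \<open>The constant of \<open>powr_balance\<close>, times the dimension from summing
    over components. The contradiction will be \<open>\<delta> \<le> K * \<delta> powr p\<close>
    against \<open>K * \<delta> powr (p - 1) < 1\<close>.\<close>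
  define K where "K = real CARD('d) * (C * C powr (\<gamma> / (1 - \<gamma>)))"
  have "((\<lambda>\<delta>. K * \<delta> powr (p - 1)) \<longlongrightarrow> K * 0 powr (p - 1)) (at_right 0)"
    using \<open>1 < p\<close> by (intro tendsto_intros tendsto_powr') (auto simp: eventually_at_filter)
  then have "\<forall>\<^sub>F \<delta> in at_right 0. K * \<delta> powr (p - 1) < 1"
    by (rule order_tendstoD) simp
  \<comment> \<open>Below 1 the indicator in the drift equals 1 up to time \<open>T\<close>; below
    \<open>norm (X t0)\<close> the level \<open>\<delta>\<close> is actually reached.\<close>
  moreover have "\<forall>\<^sub>F \<delta> in at_right 0. \<delta> \<in> {0<..<min 1 (norm (X t0))}"
    using t0 by (intro eventually_at_right_real) simp
  ultimately have "\<forall>\<^sub>F \<delta> in at_right 0. K * \<delta> powr (p - 1) < 1 \<and> \<delta> \<in> {0<..<min 1 (norm (X t0))}"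
    by eventually_elim simp
  then obtain \<delta> where small: "K * \<delta> powr (p - 1) < 1"
    and \<delta>: "0 < \<delta>" "\<delta> < 1" "\<delta> < norm (X t0)"
    using eventually_happens'[OF trivial_limit_at_right_real] by fastforce

  obtain T where T: "T \<in> {0<..1}" "norm (X T) = \<delta>" "\<And>s. s \<in> {0..T} \<Longrightarrow> norm (X s) \<le> \<delta>"
    using first_hitting_time[of 0 1 "\<lambda>t. norm (X t)" \<delta> t0] cont X0 \<delta> t0
    by (auto intro: continuous_on_norm)
  have "\<bar>X T $ i\<bar> \<le> C * C powr (\<gamma> / (1 - \<gamma>)) * \<delta> powr p" for i
  proof (cases "X T $ i = 0")
    case True
    then show ?thesis using \<open>0 < C\<close> by simp
  next
    case False
    have "continuous_on {0..T} (\<lambda>t. X t $ i)"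
      using continuous_on_subset[OF cont, of "{0..T}"] T by (auto intro: continuous_on_component)
    moreover have "\<delta> powr (-\<alpha>) \<le> sgn (X t $ i) * drift \<alpha> (X t) $ i"
      if "t \<in> {0..T}" "X t $ i \<noteq> 0" for t
      using that T \<delta> \<open>0 < \<alpha>\<close> by (intro sgn_mult_drift_ge) auto
    ultimately obtain s where s: "s \<in> {0..<T}"
      "\<bar>X T $ i\<bar> + \<delta> powr (-\<alpha>) * (T - s) \<le> \<bar>f T $ i - f s $ i\<bar>"
      using restoring_drift_bound[of T "\<lambda>t. X t $ i" "\<lambda>t. drift \<alpha> (X t) $ i" "\<lambda>t. f t $ i" "\<delta> powr (-\<alpha>)"]
        X0 False T int eq by auto
    then have "\<bar>X T $ i\<bar> + \<delta> powr (-\<alpha>) * (T - s) \<le> C * (T - s) powr \<gamma>"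
      using holder[of s T i] T by auto
    then show ?thesis
      \<comment> \<open>Here \<open>\<tau>\<close> is \<open>T - s\<close>, positive because
        \<open>s\<close> lies strictly before \<open>T\<close>.\<close>
      unfolding p_def using assms(1,2) \<delta> \<open>0 < C\<close> s by (intro powr_balance) auto
  qed
  then have "(\<Sum>i\<in>UNIV. \<bar>X T $ i\<bar>) \<le> (\<Sum>i\<in>(UNIV :: 'd set). C * C powr (\<gamma> / (1 - \<gamma>)) * \<delta> powr p)"
    by (intro sum_mono)
  \<comment> \<open>The Euclidean norm is at most the sum of the absolute values of the
    components.\<close>
  then have "\<delta> \<le> K * \<delta> powr p"
    using norm_le_l1_cart[of "X T"] T by (simp add: K_def mult.assoc)
  also have "\<dots> = (K * \<delta> powr (p - 1)) * \<delta>"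
    using \<delta> by (simp add: powr_diff)
  also have "\<dots> < 1 * \<delta>"
    using small \<delta> by (intro mult_strict_right_mono)
  finally show False by simp
qed

end
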